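(* Let $x_0\in\mathbb{R}^n$ be a fixed nonzero vector and $\bar x_0=x_0/\|x_0\|_2$. Let $\{e_i\}_{i=1}^n$ be the standard basis of $\mathbb{R}^n$ and suppose each of the $m$ rows of $A\in\mathbb{R}^{m\times n}$ is chosen independently and uniformly at random from $\{e_i\}_{i=1}^n$. Let $\hat A$ be the matrix obtained from $A$ by removing duplicate rows (keeping one copy of each distinct row). Then with probability at least $1-\exp\!\left(-\frac{m}{4n\|\bar x_0\|_\infty^2}\right)$, $$\frac{\|\hat A\bar x_0\|_2^2}{\sigma_{\min}^2(\hat A)}\le\frac{2m}{n}.$$
   Context: $\hat A$ has at most $n$ rows; $\sigma_{\min}(\hat A)$ denotes the smallest of its singular values, i.e. $\inf_{\|z\|_2=1}\|\hat A^Tz\|_2$. $\|\cdot\|_\infty$ is the maximum absolute entry. *)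

theory Defs
  imports "HOL-Probability.Probability" "Jordan_Normal_Form.Matrix"
begin

text \<open>
  Vectors and matrices are those of Jordan\_Normal\_Form, whose dimensions are natural numbers,
  because the number of rows left after removing duplicates depends on the random outcome.
  The clashing notation of HOL-Analysis is switched off.
\<close>

unbundle no vec_syntax

definition vec_norm2 :: "real Matrix.vec \<Rightarrow> real" where
  "vec_norm2 v = L2_set (\<lambda>i. v $ i) {..<dim_vec v}"

text \<open>Only meaningful for vectors of positive dimension.\<close>

definition vec_norm_inf :: "real Matrix.vec \<Rightarrow> real" where
  "vec_norm_inf v = Max ((\<lambda>i. \<bar>v $ i\<bar>) ` {..<dim_vec v})"

definition vec_normalize :: "real Matrix.vec \<Rightarrow> real Matrix.vec" where
  "vec_normalize v = (1 / vec_norm2 v) \<cdot>\<^sub>v v"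

definition std_basis :: "nat \<Rightarrow> real Matrix.vec set" where
  "std_basis n = unit_vec n ` {..<n}"

definition remove_dup_rows :: "real mat \<Rightarrow> real mat" where
  "remove_dup_rows A = mat_of_rows (dim_col A) (remdups (Matrix.rows A))"

text \<open>
  The smallest of the \<open>k\<close> singular values of a \<open>k \<times> n\<close> matrix with \<open>1 \<le> k \<le> n\<close>.  The transpose
  is essential: for \<open>k < n\<close> the infimum of \<open>\<parallel>B z\<parallel>\<close> over unit vectors \<open>z\<close> would be \<open>0\<close>.
\<close>

definition sigma_min :: "real mat \<Rightarrow> real" where
  "sigma_min B = (INF z \<in> {z \<in> carrier_vec (dim_row B). vec_norm2 z = 1}.
     vec_norm2 (transpose_mat B *\<^sub>v z))"

text \<open>
  \<open>A\<close> is a random \<open>m \<times> n\<close> matrix on the probability space \<open>M\<close> whose rows are independent and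
  uniformly distributed on the standard basis.  The joint law of the rows determines that of \<open>A\<close>.
\<close>

definition random_basis_rows ::
  "'w measure \<Rightarrow> nat \<Rightarrow> nat \<Rightarrow> ('w \<Rightarrow> real mat) \<Rightarrow> bool" where
  "random_basis_rows M m n A \<longleftrightarrow>
     (\<forall>\<omega>\<in>space M. A \<omega> \<in> carrier_mat m n) \<and>
     prob_space.indep_vars M (\<lambda>_. count_space (std_basis n))
       (\<lambda>i \<omega>. Matrix.row (A \<omega>) i) {..<m} \<and>
     (\<forall>i<m. distr M (count_space (std_basis n)) (\<lambda>\<omega>. Matrix.row (A \<omega>) i)
        = uniform_count_measure (std_basis n))"

end

theory Submission
  imports Defs
begin

text \<open>
  The distinct rows of \<open>A\<close> are orthonormal, so \<open>\<sigma>\<^sub>m\<^sub>i\<^sub>n = 1\<close> and the quotient equals the sum of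
  \<open>\<langle>e, x\<rangle>\<^sup>2\<close> over the distinct rows \<open>e\<close>.  Counting repetitions only enlarges it, to a
  sum of \<open>m\<close> independent variables in \<open>[0, \<parallel>x\<parallel>\<^sub>\<infinity>\<^sup>2]\<close> of mean \<open>1/n\<close> each.  The multiplicative
  Chernoff bound at twice the mean gives the exponent \<open>(2 ln 2 - 1) m / (n \<parallel>x\<parallel>\<^sub>\<infinity>\<^sup>2)\<close>, and
  \<open>2 ln 2 - 1 \<ge> 1/4\<close>.
\<close>

text \<open>By convexity the exponential lies below its chord on [0, ln 2]. The endpoint values are
  1 and 2, so after rescaling to [0, 1] the chord is exactly \<open>1 + z\<close>.\<close>

lemma exp_ln2_mult_le:
  fixes z :: real
  assumes "0 \<le> z" "z \<le> 1"
  shows "exp (ln 2 * z) \<le> 1 + z"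
  using convex_onD[OF exp_convex, of z 0 "ln 2"] assms by (simp add: algebra_simps)

text \<open>Exponential moment method: Markov's inequality is applied to
  \<open>exp (s * (\<Sum>i\<in>I. X i \<omega>))\<close>, and independence splits the expectation
  into factors, each at most \<open>exp (expectation (X i) / B)\<close>.\<close>

lemma (in prob_space) Chernoff_twice_mean:
  fixes X :: "'i \<Rightarrow> 'a \<Rightarrow> real"
  assumes fin: "finite I" and indep: "indep_vars (\<lambda>_. borel) X I" and B: "B > 0"
    and bounds: "\<And>i \<omega>. i \<in> I \<Longrightarrow> \<omega> \<in> space M \<Longrightarrow> X i \<omega> \<in> {0..B}"
  defines "\<mu> \<equiv> \<Sum>i\<in>I. expectation (X i)"
  shows "prob {\<omega>\<in>space M. (\<Sum>i\<in>I. X i \<omega>) \<ge> 2 * \<mu>} \<le> exp (- (\<mu> / (4 * B)))"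
proof -
  \<comment> \<open>For general \<open>s\<close> the chord bound gives the exponent
    \<open>-2 * s * \<mu> + (exp (s * B) - 1) * \<mu> / B\<close>. It is minimal at
    \<open>exp (s * B) = 2\<close>.\<close>
  define s where "s = ln 2 / B"
  have s: "s > 0" using B by (simp add: s_def)
  have rv: "X i \<in> borel_measurable M" if "i \<in> I" for i
    using indep that by (simp add: indep_vars_def)
  have int_X: "integrable M (X i)" if "i \<in> I" for i
    using bounds[OF that] rv[OF that]
    by (intro integrable_const_bound[where B=B]) auto
  have exp_le: "exp (s * X i \<omega>) \<le> 1 + X i \<omega> / B" if "i \<in> I" "\<omega> \<in> space M" for i \<omega>
    using exp_ln2_mult_le[of "X i \<omega> / B"] bounds[OF that] B by (simp add: s_def)
  have int_exp: "integrable M (\<lambda>\<omega>. exp (s * X i \<omega>))" if "i \<in> I" for i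
    using bounds[OF that] rv[OF that] s
    by (intro integrable_const_bound[where B="exp (s * B)"]) auto
  have exp_indep: "indep_vars (\<lambda>_. borel) (\<lambda>i \<omega>. exp (s * X i \<omega>)) I"
    by (rule indep_vars_compose2[OF indep]) auto
  have exp_prod: "exp (s * (\<Sum>i\<in>I. X i \<omega>)) = (\<Prod>i\<in>I. exp (s * X i \<omega>))" for \<omega>
    by (simp add: sum_distrib_left exp_sum fin)
  have int_prod: "integrable M (\<lambda>\<omega>. \<Prod>i\<in>I. exp (s * X i \<omega>))"
    by (rule indep_vars_integrable[OF fin exp_indep int_exp])
  have mu_nonneg: "0 \<le> expectation (X i)" if "i \<in> I" for i
    using bounds[OF that] by (intro integral_nonneg_AE) auto
  have mgf: "expectation (\<lambda>\<omega>. exp (s * X i \<omega>)) \<le> exp (expectation (X i) / B)" if "i \<in> I" for i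
  proof -
    have "expectation (\<lambda>\<omega>. exp (s * X i \<omega>)) \<le> expectation (\<lambda>\<omega>. 1 + X i \<omega> / B)"
      using int_exp[OF that] int_X[OF that] exp_le[OF that]
      by (intro integral_mono) auto
    also have "\<dots> = 1 + expectation (X i) / B"
      using int_X[OF that] by (simp add: prob_space)
    also have "\<dots> \<le> exp (expectation (X i) / B)"
      by (rule exp_ge_add_one_self)
    finally show ?thesis .
  qed
  have "prob {\<omega>\<in>space M. (\<Sum>i\<in>I. X i \<omega>) \<ge> 2 * \<mu>}
      \<le> exp (- s * (2 * \<mu>)) * (\<integral>\<omega>\<in>space M. exp (s * (\<Sum>i\<in>I. X i \<omega>)) \<partial>M)"
    using integrable_mult_indicator[OF sets.top int_prod]
    by (intro Chernoff_ineq_ge s) (simp_all add: exp_prod set_integrable_def)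
  also have "(\<integral>\<omega>\<in>space M. exp (s * (\<Sum>i\<in>I. X i \<omega>)) \<partial>M)
      = (\<Prod>i\<in>I. expectation (\<lambda>\<omega>. exp (s * X i \<omega>)))"
    using indep_vars_lebesgue_integral[OF fin exp_indep int_exp] int_prod
    by (simp add: set_integral_space exp_prod)
  also have "exp (- s * (2 * \<mu>)) * \<dots> \<le> exp (- s * (2 * \<mu>)) * (\<Prod>i\<in>I. exp (expectation (X i) / B))"
    using mgf by (intro mult_left_mono prod_mono) (auto intro!: integral_nonneg_AE)
  also have "\<dots> = exp (\<mu> / B - 2 * s * \<mu>)"
    by (simp add: exp_sum[OF fin, symmetric] \<mu>_def sum_divide_distrib mult_exp_exp)
  also have "\<dots> \<le> exp (- (\<mu> / (4 * B)))"
  proof -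
    have "\<mu> \<ge> 0" using mu_nonneg by (simp add: \<mu>_def sum_nonneg)
    \<comment> \<open>The exponent is \<open>(1 - 2 * ln 2) * \<mu> / B\<close>, and the claim asks
      for \<open>- 1 / 4\<close> as coefficient, hence 5/4 = 1 + 1/4. It suffices that 2 ln 2 is at
      least 4/3.\<close>
    hence "\<mu> / B * (5 / 4) \<le> \<mu> / B * (2 * ln 2)"
      using ln2_ge_two_thirds B by (intro mult_left_mono) auto
    thus ?thesis using B by (simp add: s_def field_simps)
  qed
  finally show ?thesis .
qed

lemma vec_norm2_sq: "(vec_norm2 v)\<^sup>2 = scalar_prod v v"
  by (simp add: vec_norm2_def L2_set_def sum_nonneg scalar_prod_def power2_eq_square lessThan_atLeast0)

lemma vec_norm2_nonneg: "0 \<le> vec_norm2 v"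
  by (simp add: vec_norm2_def)

text \<open>Moving \<open>B\<close> across the scalar product gives |B^T z|^2 = <z, B B^T z> =
  |z|^2. So \<open>transpose_mat B\<close> is an isometry, and the infimum runs over the single
  value 1.\<close>

lemma sigma_min_orthonormal_rows:
  fixes B :: "real mat"
  assumes B: "B \<in> carrier_mat k n" and k: "0 < k"
    and orth: "B * transpose_mat B = 1\<^sub>m k"
  shows "sigma_min B = 1"
proof -
  have iso: "vec_norm2 (transpose_mat B *\<^sub>v z) = vec_norm2 z" if z: "z \<in> carrier_vec k" for z
  proof -
    have Bz: "transpose_mat B *\<^sub>v z \<in> carrier_vec n" using B z by simp
    have "scalar_prod (transpose_mat B *\<^sub>v z) (transpose_mat B *\<^sub>v z)
        = scalar_prod z (B *\<^sub>v (transpose_mat B *\<^sub>v z))"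
      by (rule transpose_vec_mult_scalar[OF B Bz z])
    also have "B *\<^sub>v (transpose_mat B *\<^sub>v z) = z"
      using assoc_mult_mat_vec[OF B, of "transpose_mat B" k z] B z orth by simp
    finally have "(vec_norm2 (transpose_mat B *\<^sub>v z))\<^sup>2 = (vec_norm2 z)\<^sup>2"
      by (simp add: vec_norm2_sq)
    thus ?thesis by (simp add: vec_norm2_nonneg)
  qed
  \<comment> \<open>A unit vector has to be exhibited, since otherwise the infimum would be over the
    empty set; \<open>0 < k\<close> makes the index 0 available.\<close>
  have "(vec_norm2 (unit_vec k 0 :: real Matrix.vec))\<^sup>2 = 1\<^sup>2"
    unfolding vec_norm2_sq using k by (simp add: scalar_prod_left_unit)
  hence "vec_norm2 (unit_vec k 0 :: real Matrix.vec) = 1"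
    by (simp add: power2_eq_1_iff) (use vec_norm2_nonneg[of "unit_vec k 0"] in linarith)
  hence ne: "unit_vec k 0 \<in> {z \<in> carrier_vec (dim_row B). vec_norm2 z = 1}"
    using B by simp
  have "(\<lambda>z. vec_norm2 (transpose_mat B *\<^sub>v z)) ` {z \<in> carrier_vec (dim_row B). vec_norm2 z = 1} = {1}"
    using ne iso B by (auto intro!: image_eqI[OF _ ne])
  thus ?thesis by (simp add: sigma_min_def)
qed

lemma std_basis_carrier: "std_basis n \<subseteq> carrier_vec n"
  by (auto simp: std_basis_def)

lemma inj_on_unit_vec: "inj_on (unit_vec n :: nat \<Rightarrow> real Matrix.vec) {..<n}"
  by (auto simp: inj_on_def)

lemma finite_std_basis: "finite (std_basis n)"
  by (simp add: std_basis_def)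

lemma card_std_basis: "card (std_basis n) = n"
  by (simp add: std_basis_def card_image inj_on_unit_vec)

lemma std_basis_scalar_prod:
  "u \<in> std_basis n \<Longrightarrow> v \<in> std_basis n \<Longrightarrow> scalar_prod u v = (if u = v then 1 else 0)"
  by (auto simp: std_basis_def scalar_prod_left_unit)

text \<open>Distinct standard basis vectors are orthonormal, so the denominator is 1. The numerator
  is a sum over the remaining list of rows; as the list is distinct, this is a sum over the set of
  rows of \<open>B\<close>.\<close>

lemma quotient_remove_dup_rows:
  fixes B :: "real mat"
  assumes B: "B \<in> carrier_mat m n" and m: "0 < m" and x: "x \<in> carrier_vec n"
    and rows_B: "\<And>i. i < m \<Longrightarrow> Matrix.row B i \<in> std_basis n"
  shows "(vec_norm2 (remove_dup_rows B *\<^sub>v x))\<^sup>2 / (sigma_min (remove_dup_rows B))\<^sup>2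
    = (\<Sum>e\<in>(\<lambda>i. Matrix.row B i) ` {..<m}. (scalar_prod e x)\<^sup>2)"
proof -
  define L where "L = remdups (Matrix.rows B)"
  define k where "k = length L"
  have set_L: "set L = (\<lambda>i. Matrix.row B i) ` {..<m}"
    using B by (auto simp: L_def Matrix.rows_def)
  have dist: "distinct L" by (simp add: L_def)
  have L_std: "L ! i \<in> std_basis n" if "i < k" for i
    using that rows_B set_L nth_mem[of i L] by (auto simp: k_def)
  have L_carrier: "L ! i \<in> carrier_vec n" if "i < k" for i
    using L_std[OF that] std_basis_carrier by auto
  have R: "remove_dup_rows B = mat_of_rows n L"
    using B by (simp add: remove_dup_rows_def L_def)
  have Rc: "mat_of_rows n L \<in> carrier_mat k n" by (simp add: k_def)
  have "set L \<noteq> {}" using m by (auto simp: set_L)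
  hence k: "0 < k" by (simp add: k_def)
  \<comment> \<open>Here the removal of duplicates enters: in a distinct list equal entries have
    equal indices, so the off-diagonal Gram entries vanish.\<close>
  have "scalar_prod (L ! i) (L ! j) = (if i = j then 1 else 0)" if "i < k" "j < k" for i j
    using std_basis_scalar_prod[OF L_std L_std, OF that] that dist
    by (simp add: k_def nth_eq_iff_index_eq)
  hence "mat_of_rows n L * transpose_mat (mat_of_rows n L) = 1\<^sub>m k"
    using Rc L_carrier by (intro eq_matI) (auto simp: k_def)
  hence sigma: "sigma_min (mat_of_rows n L) = 1"
    by (rule sigma_min_orthonormal_rows[OF Rc k])
  have "(vec_norm2 (mat_of_rows n L *\<^sub>v x))\<^sup>2 = (\<Sum>i<k. (scalar_prod (L ! i) x)\<^sup>2)"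
    using L_carrier unfolding vec_norm2_sq
    by (simp add: scalar_prod_def[of "mat_of_rows n L *\<^sub>v x"] k_def
        lessThan_atLeast0 power2_eq_square)
  also have "\<dots> = (\<Sum>e\<in>set L. (scalar_prod e x)\<^sup>2)"
    using sum.reindex_bij_betw[OF bij_betw_nth[OF dist refl refl], of "\<lambda>e. (scalar_prod e x)\<^sup>2"]
    by (simp add: k_def)
  finally show ?thesis by (simp add: R sigma set_L)
qed

lemma vec_norm2_normalize:
  assumes "v \<in> carrier_vec n" "v \<noteq> 0\<^sub>v n"
  shows "vec_norm2 (vec_normalize v) = 1"
proof -
  have "vec_norm2 v \<noteq> 0"
  proof
    assume "vec_norm2 v = 0"
    hence "v $ i = 0" if "i < n" for i
      using that assms(1) by (simp add: vec_norm2_def L2_set_eq_0_iff)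
    hence "v = 0\<^sub>v n" using assms(1) by (intro eq_vecI) auto
    with assms(2) show False by contradiction
  qed
  moreover have "vec_norm2 (vec_normalize v) = \<bar>1 / vec_norm2 v\<bar> * vec_norm2 v"
    by (simp add: vec_normalize_def vec_norm2_def L2_set_def power_mult_distrib power_divide
        sum_divide_distrib[symmetric] real_sqrt_divide)
  ultimately show ?thesis using vec_norm2_nonneg[of v] by simp
qed

lemma abs_le_vec_norm_inf: "i < dim_vec v \<Longrightarrow> \<bar>v $ i\<bar> \<le> vec_norm_inf v"
  by (simp add: vec_norm_inf_def)

text \<open>Parseval's identity for the standard basis. For a unit vector the sum is 1, so a
  uniformly chosen basis vector contributes 1/n on average.\<close>

lemma sum_std_basis_scalar_prod_sq:
  assumes "x \<in> carrier_vec n"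
  shows "(\<Sum>e\<in>std_basis n. (scalar_prod e x)\<^sup>2) = (vec_norm2 x)\<^sup>2"
  using assms unfolding std_basis_def
  by (subst sum.reindex[OF inj_on_unit_vec])
    (simp add: scalar_prod_left_unit vec_norm2_def L2_set_def sum_nonneg)

theorem proposition4p2:
  fixes M :: "'w measure" and A :: "'w \<Rightarrow> real mat"
    and m n :: nat and x0 :: "real Matrix.vec"
  assumes "prob_space M"
    and "x0 \<in> carrier_vec n"
    and "x0 \<noteq> 0\<^sub>v n"
    and "random_basis_rows M m n A"
  shows "measure M {\<omega> \<in> space M.
            (vec_norm2 (remove_dup_rows (A \<omega>) *\<^sub>v vec_normalize x0))\<^sup>2
              / (sigma_min (remove_dup_rows (A \<omega>)))\<^sup>2 \<le> 2 * real m / real n}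
         \<ge> 1 - exp (- (real m / (4 * real n * (vec_norm_inf (vec_normalize x0))\<^sup>2)))"
proof (cases "m = 0")
  case True
  \<comment> \<open>With no rows the exponent is 0 and the claimed lower bound is 1 - exp 0 = 0, so
    the value of \<open>sigma_min\<close> on an empty matrix does not matter.\<close>
  thus ?thesis by simp
next
  case False
  interpret prob_space M by fact
  define x where "x = vec_normalize x0"
  define h where "h = (\<lambda>e. (scalar_prod e x)\<^sup>2)"
  define row where "row = (\<lambda>i \<omega>. Matrix.row (A \<omega>) i)"
  \<comment> \<open>The target event with the quotient already replaced by the sum over distinct
    rows; the two are identified at the end.\<close>
  define good where "good = {\<omega> \<in> space M. (\<Sum>e\<in>(\<lambda>i. row i \<omega>) ` {..<m}. h e) \<le> 2 * real m / real n}"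
  have x: "x \<in> carrier_vec n" using assms(2) by (simp add: x_def vec_normalize_def)
  have x1: "vec_norm2 x = 1" using vec_norm2_normalize[OF assms(2,3)] by (simp add: x_def)
  have A: "A \<omega> \<in> carrier_mat m n" if "\<omega> \<in> space M" for \<omega>
    using assms(4) that by (simp add: random_basis_rows_def)
  have indep: "indep_vars (\<lambda>_. count_space (std_basis n)) row {..<m}"
    and distr: "\<And>i. i < m \<Longrightarrow>
      distr M (count_space (std_basis n)) (row i) = uniform_count_measure (std_basis n)"
    using assms(4) by (simp_all add: random_basis_rows_def row_def)
  have rv: "row i \<in> M \<rightarrow>\<^sub>M count_space (std_basis n)" if "i < m" for i
    using indep that by (simp add: indep_vars_def)
  have row_std: "row i \<omega> \<in> std_basis n" if "i < m" "\<omega> \<in> space M" for i \<omega>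
    using measurable_space[OF rv[OF that(1)] that(2)] by simp

  define b where "b = (vec_norm_inf x)\<^sup>2"
  have h_le: "h e \<le> b" if "e \<in> std_basis n" for e
  proof -
    from that obtain i where "i < n" "e = unit_vec n i" by (auto simp: std_basis_def)
    thus ?thesis
      using x abs_le_vec_norm_inf[of i x] power_mono[of "\<bar>x $ i\<bar>" "vec_norm_inf x" 2]
      by (simp add: h_def b_def scalar_prod_left_unit)
  qed
  have sum_h: "(\<Sum>e\<in>std_basis n. h e) = 1"
    by (simp add: h_def sum_std_basis_scalar_prod_sq[OF x] x1)
  \<comment> \<open>The Chernoff bound needs a positive range. If \<open>b\<close> were not
    positive, every \<open>h e\<close> would be at most 0, although these values sum to 1.\<close>
  have b: "b > 0"
  proof (rule ccontr)
    assume "\<not> b > 0"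
    hence "(\<Sum>e\<in>std_basis n. h e) \<le> 0"
      using h_le by (intro sum_nonpos) fastforce
    with sum_h show False by simp
  qed

  have mean: "expectation (\<lambda>\<omega>. h (row i \<omega>)) = 1 / n" if "i < m" for i
  proof -
    have "expectation (\<lambda>\<omega>. h (row i \<omega>))
        = (\<integral>e. h e \<partial>distr M (count_space (std_basis n)) (row i))"
      by (rule integral_distr[symmetric, OF rv[OF that]]) auto
    also have "\<dots> = 1 / n"
      using finite_std_basis sum_h
      by (simp add: distr[OF that] uniform_count_measure_def lebesgue_integral_point_measure_finite
          card_std_basis sum_divide_distrib[symmetric])
    finally show ?thesis .
  qed
  have indep_h: "indep_vars (\<lambda>_. borel) (\<lambda>i \<omega>. h (row i \<omega>)) {..<m}"
    by (rule indep_vars_compose2[OF indep]) auto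
  have rv_h: "(\<lambda>\<omega>. h (row i \<omega>)) \<in> borel_measurable M" if "i < m" for i
    using indep_h that by (simp add: indep_vars_def)
  \<comment> \<open>Rows are counted with multiplicity here, so the sum has independent terms. Its
    mean is m/n, which makes the threshold exactly twice the mean.\<close>
  define bad where "bad = {\<omega>\<in>space M. (\<Sum>i<m. h (row i \<omega>)) \<ge> 2 * real m / real n}"
  have bad_sets: "bad \<in> events"
    unfolding bad_def using rv_h by measurable
  have "prob bad \<le> exp (- (real m / (4 * real n * b)))"
    using Chernoff_twice_mean[OF _ indep_h b] h_le row_std mean
    by (simp add: bad_def h_def field_simps)

  moreover have "space M - bad \<subseteq> good"
  proof
    fix \<omega> assume \<omega>: "\<omega> \<in> space M - bad"
    \<comment> \<open>As \<open>h\<close> is nonnegative, counting each distinct row once can only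
      decrease the sum.\<close>
    have "(\<Sum>e\<in>(\<lambda>i. row i \<omega>) ` {..<m}. h e) \<le> (\<Sum>i<m. h (row i \<omega>))"
      using sum_image_le[of "{..<m}" h "\<lambda>i. row i \<omega>"] by (simp add: h_def o_def)
    with \<omega> show "\<omega> \<in> good" by (auto simp: good_def bad_def)
  qed
  \<comment> \<open>Monotonicity of the measure requires \<open>good\<close> to be measurable. Its
    sum ranges over a random set of rows, so it is rewritten over the fixed finite basis, with
    \<open>h e\<close> switched on exactly when \<open>e\<close> occurs as a row.\<close>
  moreover have "good \<in> events"
  proof -
    have [measurable]: "{\<omega>\<in>space M. row i \<omega> = e} \<in> events" if "i < m" "e \<in> std_basis n" for i e
    proof -
      have "row i -` {e} \<inter> space M \<in> events"
        using that by (intro measurable_sets[OF rv]) auto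
      also have "row i -` {e} \<inter> space M = {\<omega>\<in>space M. row i \<omega> = e}" by auto
      finally show ?thesis .
    qed
    have "{\<omega>\<in>space M. \<exists>i\<in>{..<m}. row i \<omega> = e} \<in> events" if "e \<in> std_basis n" for e
      using that by (intro sets.sets_Collect_finite_Ex) auto
    hence "(\<lambda>\<omega>. \<Sum>e\<in>std_basis n. if \<exists>i\<in>{..<m}. row i \<omega> = e then h e else 0) \<in> borel_measurable M"
      by (intro borel_measurable_sum measurable_If) auto
    hence "{\<omega>\<in>space M. (\<Sum>e\<in>std_basis n. if \<exists>i\<in>{..<m}. row i \<omega> = e then h e else 0)
        \<le> 2 * real m / real n} \<in> events"
      by measurable
    also have "{\<omega>\<in>space M. (\<Sum>e\<in>std_basis n. if \<exists>i\<in>{..<m}. row i \<omega> = e then h e else 0)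
        \<le> 2 * real m / real n} = good"
    proof -
      have "(\<Sum>e\<in>std_basis n. if \<exists>i\<in>{..<m}. row i \<omega> = e then h e else 0)
          = (\<Sum>e\<in>(\<lambda>i. row i \<omega>) ` {..<m}. h e)" if "\<omega> \<in> space M" for \<omega>
        using row_std that finite_std_basis
        by (intro sum.mono_neutral_cong_right) auto
      thus ?thesis by (auto simp: good_def)
    qed
    finally show ?thesis .
  qed
  ultimately have "1 - exp (- (real m / (4 * real n * b))) \<le> prob good"
    using finite_measure_mono[of "space M - bad" good] prob_compl[OF bad_sets] by simp
  moreover have "good = {\<omega> \<in> space M.
      (vec_norm2 (remove_dup_rows (A \<omega>) *\<^sub>v x))\<^sup>2 / (sigma_min (remove_dup_rows (A \<omega>)))\<^sup>2
        \<le> 2 * real m / real n}"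
    unfolding good_def
    using quotient_remove_dup_rows[OF A _ x] False row_std
    by (intro Collect_cong) (auto simp: row_def h_def)
  ultimately show ?thesis by (simp add: b_def x_def)
qed

end
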